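(* Let $A$ be a finite alphabet of colors and let $J$ be a sentence over $A$. Then the colored dual immaculate function expands in the colored monomial basis as $$\mathfrak{S}^*_J=\sum_{B} K_{J,B}\,M_B,$$ where the sum runs over all sentences $B$ over $A$ with $|B|=|J|$, and $K_{J,B}$ is the number of colored immaculate tableaux of shape $J$ and type $B$ (in particular all coefficients are nonnegative).
   Context: Words over $A$ are finite sequences of colors; a sentence is a finite sequence $I=(w_1,\dots,w_k)$ of nonempty words, a weak sentence may also contain empty words. $|I|$ is the total number of letters, $\ell(I)=k$. Let $x_{a,i}$ ($a\in A$, $i\in\mathbb{Z}_{>0}$) be variables subject only to the relations $x_{a,i}x_{b,j}=x_{b,j}x_{a,i}$ for $i\neq j$ (variables with the same second index and different colors do not commute). For a word $w=c_1\cdots c_r$ put $x_{w,i}=x_{c_1,i}\cdots x_{c_r,i}$ and $x_{\emptyset,i}=1$. For a sentence $I=(w_1,\dots,w_k)$, the colored monomial quasisymmetric function is $M_I=\sum_{1\le j_1<\dots<j_k}x_{w_1,j_1}\cdots x_{w_k,j_k}$. For a sentence $J=(w_1,\dots,w_k)$ the colored composition diagram of shape $J$ has $k$ left-justified rows (row 1 on top), row $i$ having $|w_i|$ boxes, the $j$-th box of row $i$ colored by the $j$-th letter of $w_i$. A colored immaculate tableau (CIT) of shape $J$ is a filling of the boxes of this diagram by positive integers such that entries weakly increase from left to right in each row and strictly increase from top to bottom in the first column. The type of a CIT $T$ is the weak sentence $B=(u_1,\dots,u_m)$ ($m$ the largest entry) where $u_i$ is the word of colors of the boxes containing $i$, read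 row by row from the lowest row to the highest row and from left to right within each row ($u_i=\emptyset$ if no box contains $i$). Set $x_T=x_{u_1,1}x_{u_2,2}\cdots x_{u_m,m}$. The colored dual immaculate function is $\mathfrak{S}^*_J=\sum_T x_T$, summed over all CIT $T$ of shape $J$. *)

theory Defs
  imports Main
begin

type_synonym 'a sentence = "'a list list"

text \<open>Sentences over \<open>A\<close>; the empty sentence is allowed.  Weak sentences, which may contain
  empty words, are arbitrary elements of \<^typ>\<open>'a sentence\<close>.\<close>

definition sentences :: "'a set \<Rightarrow> 'a sentence set" where
  "sentences A = {I. \<forall>w\<in>set I. w \<noteq> [] \<and> set w \<subseteq> A}"

definition sentence_size :: "'a sentence \<Rightarrow> nat" where
  "sentence_size I = (\<Sum>w\<leftarrow>I. length w)"


text \<open>The pair \<open>(a, i)\<close> is the variable \<open>x_{a,i}\<close>.  Monomials are the elements of the monoid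
  generated by the variables subject only to \<open>x_{a,i} x_{b,j} = x_{b,j} x_{a,i}\<close> for \<open>i \<noteq> j\<close>.
  Only variables with positive second index are used below.\<close>

inductive swap_step :: "('a \<times> nat) list \<Rightarrow> ('a \<times> nat) list \<Rightarrow> bool" where
  "i \<noteq> j \<Longrightarrow> swap_step (u @ [(a, i), (b, j)] @ v) (u @ [(b, j), (a, i)] @ v)"

quotient_type 'a monomial = "('a \<times> nat) list" / "equivclp swap_step"
  by (rule equivp_evquivclp)

lemma swap_step_append:
  assumes "swap_step u u'"
  shows "swap_step (p @ u @ q) (p @ u' @ q)"
  using assms
proof cases
  case (1 i j s a b t)
  then show ?thesis
    using swap_step.intros[of i j "p @ s" a b "t @ q"] by simp
qed

lemma equivclp_swap_step_append:
  assumes "equivclp swap_step u u'"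
  shows "equivclp swap_step (p @ u @ q) (p @ u' @ q)"
  using assms
proof (induction rule: equivclp_induct)
  case base
  show ?case by simp
next
  case (step y z)
  then have "swap_step (p @ y @ q) (p @ z @ q) \<or> swap_step (p @ z @ q) (p @ y @ q)"
    using swap_step_append by blast
  with step.IH show ?case
    by (rule equivclp_into_equivclp)
qed

instantiation monomial :: (type) monoid_mult
begin

lift_definition one_monomial :: "'a monomial" is "[]" .

lift_definition times_monomial :: "'a monomial \<Rightarrow> 'a monomial \<Rightarrow> 'a monomial" is "(@)"
proof -
  fix u u' v v' :: "('a \<times> nat) list"
  assume "equivclp swap_step u u'" "equivclp swap_step v v'"
  then have "equivclp swap_step (u @ v) (u' @ v)" "equivclp swap_step (u' @ v) (u' @ v')"
    using equivclp_swap_step_append[of u u' "[]" v] equivclp_swap_step_append[of v v' u' "[]"]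
    by simp_all
  then show "equivclp swap_step (u @ v) (u' @ v')"
    by (rule equivclp_trans)
qed

instance
  by standard (transfer, simp)+

end

lift_definition var :: "'a \<Rightarrow> nat \<Rightarrow> 'a monomial" is "\<lambda>a i. [(a, i)]" .

definition word_monomial :: "'a list \<Rightarrow> nat \<Rightarrow> 'a monomial" where
  "word_monomial w i = (\<Prod>c\<leftarrow>w. var c i)"

text \<open>\<open>x_{w_1,j_1} \<cdots> x_{w_k,j_k}\<close>\<close>

definition sentence_monomial :: "'a sentence \<Rightarrow> nat list \<Rightarrow> 'a monomial" where
  "sentence_monomial I js = prod_list (map2 word_monomial I js)"


text \<open>Formal power series (possibly infinite linear combinations of monomials), given by their
  coefficients.  The formal sum of a family of series is taken coefficientwise; it is meaningful
  if every monomial occurs in only finitely many members of the family, which is shown below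
  for the two families used.\<close>

type_synonym ('a, 'r) series = "'a monomial \<Rightarrow> 'r"

definition monomial_series :: "'a monomial \<Rightarrow> ('a, 'r::comm_ring_1) series" where
  "monomial_series m = (\<lambda>n. if n = m then 1 else 0)"

definition formal_sum :: "('i \<Rightarrow> ('a, 'r::comm_ring_1) series) \<Rightarrow> 'i set \<Rightarrow> ('a, 'r) series" where
  "formal_sum f S = (\<lambda>m. \<Sum>i\<in>{i\<in>S. f i m \<noteq> 0}. f i m)"

definition increasing_indices :: "nat \<Rightarrow> nat list set" where
  "increasing_indices k = {js. length js = k \<and> sorted_wrt (<) js \<and> (\<forall>j\<in>set js. 1 \<le> j)}"

definition colored_M :: "'a sentence \<Rightarrow> ('a, 'r::comm_ring_1) series" where
  "colored_M I =
    formal_sum (\<lambda>js. monomial_series (sentence_monomial I js)) (increasing_indices (length I))"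


text \<open>A filling of the diagram of shape \<open>J\<close> is the list of its rows, from top to bottom; the color
  of the box with entry \<open>T ! r ! c\<close> is \<open>J ! r ! c\<close>.\<close>

definition is_CIT :: "'a sentence \<Rightarrow> nat list list \<Rightarrow> bool" where
  "is_CIT J T \<longleftrightarrow>
     map length T = map length J \<and>
     (\<forall>t\<in>set T. \<forall>e\<in>set t. 1 \<le> e) \<and>
     (\<forall>t\<in>set T. sorted t) \<and>
     sorted_wrt (<) (map hd T)"

definition max_entry :: "nat list list \<Rightarrow> nat" where
  "max_entry T = Max (insert 0 (set (concat T)))"

definition row_colors :: "nat \<Rightarrow> 'a list \<Rightarrow> nat list \<Rightarrow> 'a list" where
  "row_colors i w t = map fst (filter (\<lambda>(c, e). e = i) (zip w t))"

text \<open>The rows are read from the lowest to the highest, hence \<^const>\<open>rev\<close>.\<close>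

definition entry_word :: "'a sentence \<Rightarrow> nat list list \<Rightarrow> nat \<Rightarrow> 'a list" where
  "entry_word J T i = concat (rev (map2 (row_colors i) J T))"

definition CIT_type :: "'a sentence \<Rightarrow> nat list list \<Rightarrow> 'a sentence" where
  "CIT_type J T = map (entry_word J T) [1..<Suc (max_entry T)]"

definition CIT_monomial :: "'a sentence \<Rightarrow> nat list list \<Rightarrow> 'a monomial" where
  "CIT_monomial J T = sentence_monomial (CIT_type J T) [1..<Suc (max_entry T)]"

definition dual_immaculate :: "'a sentence \<Rightarrow> ('a, 'r::comm_ring_1) series" where
  "dual_immaculate J = formal_sum (\<lambda>T. monomial_series (CIT_monomial J T)) {T. is_CIT J T}"

definition CIT_count :: "'a sentence \<Rightarrow> 'a sentence \<Rightarrow> nat" where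
  "CIT_count J B = card {T. is_CIT J T \<and> CIT_type J T = B}"


text \<open>Finiteness of the sums and cardinalities above.\<close>

lift_definition indices :: "'a monomial \<Rightarrow> nat set" is "\<lambda>u. snd ` set u"
proof -
  fix u v :: "('a \<times> nat) list"
  assume "equivclp swap_step u v"
  then show "snd ` set u = snd ` set v"
    by (induction rule: equivclp_induct) (auto elim!: swap_step.cases)
qed

lemma finite_indices: "finite (indices m)"
  by transfer simp

lemma indices_one [simp]: "indices 1 = {}"
  by transfer simp

lemma indices_times [simp]: "indices (m * n) = indices m \<union> indices n"
  by transfer auto

lemma indices_var [simp]: "indices (var a i) = {i}"
  by transfer simp

lemma indices_word_monomial: "indices (word_monomial w i) = (if w = [] then {} else {i})"
  unfolding word_monomial_def by (induction w) auto

lemma indices_sentence_monomial: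
  "indices (sentence_monomial I js) = {j. \<exists>w. (w, j) \<in> set (zip I js) \<and> w \<noteq> []}"
proof -
  have "indices (prod_list (map (\<lambda>(w, j). word_monomial w j) ps)) =
      {j. \<exists>w. (w, j) \<in> set ps \<and> w \<noteq> []}" for ps :: "('a list \<times> nat) list"
    by (induction ps) (auto simp: indices_word_monomial split: if_splits)
  then show ?thesis
    unfolding sentence_monomial_def .
qed

lemma finite_colored_M_family:
  assumes "I \<in> sentences A"
  shows "finite {js \<in> increasing_indices (length I). sentence_monomial I js = m}"
proof (rule finite_subset)
  show "{js \<in> increasing_indices (length I). sentence_monomial I js = m}
      \<subseteq> {js. set js \<subseteq> indices m \<and> length js = length I}"
  proof (clarify, intro conjI subsetI)
    fix js j
    assume js: "js \<in> increasing_indices (length I)" and j: "j \<in> set js"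
    then obtain k where k: "k < length js" "j = js ! k"
      by (auto simp: in_set_conv_nth)
    have len: "length js = length I"
      using js by (simp add: increasing_indices_def)
    with k have "(I ! k, j) \<in> set (zip I js)"
      by (auto simp: set_zip)
    moreover have "I ! k \<noteq> []"
      using assms k len by (simp add: sentences_def)
    ultimately show "j \<in> indices (sentence_monomial I js)"
      by (auto simp: indices_sentence_monomial)
  qed (simp add: increasing_indices_def)
  show "finite {js. set js \<subseteq> indices m \<and> length js = length I}"
    by (rule finite_lists_length_eq) (rule finite_indices)
qed

lemma finite_fillings:
  assumes "finite E"
  shows "finite {T. map length T = map length J \<and> set (concat T) \<subseteq> E}"
proof (rule finite_subset)
  let ?R = "{t. set t \<subseteq> E \<and> length t \<le> sum_list (map length J)}"
  show "{T. map length T = map length J \<and> set (concat T) \<subseteq> E}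
      \<subseteq> {T. set T \<subseteq> ?R \<and> length T = length J}"
  proof clarsimp
    fix T assume T: "map length T = map length J" "(\<Union>x\<in>set T. set x) \<subseteq> E"
    have "length t \<le> sum_list (map length J)" if "t \<in> set T" for t
      using that member_le_sum_list[of "length t" "map length T"] unfolding T(1)[symmetric] by simp
    moreover have "length T = length J"
      using T(1) by (rule map_eq_imp_length_eq)
    ultimately show "set T \<subseteq> ?R \<and> length T = length J"
      using T(2) by blast
  qed
  show "finite {T. set T \<subseteq> ?R \<and> length T = length J}"
    by (intro finite_lists_length_eq finite_lists_length_le assms)
qed

lemma entry_word_nonempty:
  assumes "map length T = map length J" "e \<in> set (concat T)"
  shows "entry_word J T e \<noteq> []"
proof -
  from assms(2) obtain r c where r: "r < length T" and c: "c < length (T ! r)"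
    and e: "e = T ! r ! c"
    by (auto simp: in_set_conv_nth)
  have len: "length T = length J"
    using assms(1) by (rule map_eq_imp_length_eq)
  have "length (T ! r) = length (J ! r)"
    using assms(1) r len nth_map[of r T length] nth_map[of r J length] by simp
  then have "(J ! r ! c, e) \<in> set (zip (J ! r) (T ! r))"
    using c e by (auto simp: set_zip)
  then have "row_colors e (J ! r) (T ! r) \<noteq> []"
    by (auto simp: row_colors_def filter_empty_conv)
  moreover have "(J ! r, T ! r) \<in> set (zip J T)"
    using r len by (auto simp: set_zip)
  ultimately show ?thesis
    unfolding entry_word_def concat_eq_Nil_conv set_rev set_map by blast
qed

lemma entry_le_max_entry: "e \<in> set (concat T) \<Longrightarrow> e \<le> max_entry T"
  unfolding max_entry_def by (rule Max_ge) auto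

lemma finite_dual_immaculate_family: "finite {T. is_CIT J T \<and> CIT_monomial J T = m}"
proof (rule finite_subset)
  show "{T. is_CIT J T \<and> CIT_monomial J T = m}
      \<subseteq> {T. map length T = map length J \<and> set (concat T) \<subseteq> indices m}"
  proof (clarify, intro conjI subsetI)
    fix T e assume T: "is_CIT J T" and e: "e \<in> set (concat T)"
    have "1 \<le> e"
      using T e by (auto simp: is_CIT_def)
    with entry_le_max_entry[OF e]
    have "e \<in> set [1..<Suc (max_entry T)]"
      by auto
    then have "(entry_word J T e, e) \<in> set (zip (CIT_type J T) [1..<Suc (max_entry T)])"
      unfolding CIT_type_def zip_map1 zip_same_conv_map by (auto simp del: set_upt upt_Suc)
    moreover have "entry_word J T e \<noteq> []"
      using T e by (intro entry_word_nonempty) (simp_all add: is_CIT_def)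
    ultimately show "e \<in> indices (CIT_monomial J T)"
      unfolding CIT_monomial_def indices_sentence_monomial by blast
  qed (simp add: is_CIT_def)
  show "finite {T. map length T = map length J \<and> set (concat T) \<subseteq> indices m}"
    by (rule finite_fillings) (rule finite_indices)
qed

lemma finite_CIT_of_type: "finite {T. is_CIT J T \<and> CIT_type J T = B}"
proof (rule finite_subset)
  have "length (CIT_type J T) = max_entry T" for T
    by (simp add: CIT_type_def)
  then show "{T. is_CIT J T \<and> CIT_type J T = B}
      \<subseteq> {T. is_CIT J T \<and> CIT_monomial J T = sentence_monomial B [1..<Suc (length B)]}"
    by (auto simp: CIT_monomial_def)
qed (rule finite_dual_immaculate_family)

lemma finite_sentences_of_size:
  assumes "finite A"
  shows "finite {B \<in> sentences A. sentence_size B = n}"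
proof (rule finite_subset)
  let ?W = "{w. set w \<subseteq> A \<and> length w \<le> n}"
  have len: "length B \<le> sentence_size B" if "B \<in> sentences A" for B
  proof -
    from that have "\<forall>w\<in>set B. 1 \<le> length w"
      by (auto simp: sentences_def Suc_le_eq)
    then show ?thesis
      by (induction B) (auto simp: sentence_size_def)
  qed
  have "length w \<le> sentence_size B" if "w \<in> set B" for w and B :: "'a sentence"
    using that member_le_sum_list[of "length w" "map length B"] by (simp add: sentence_size_def)
  with len show "{B \<in> sentences A. sentence_size B = n} \<subseteq> {B. set B \<subseteq> ?W \<and> length B \<le> n}"
    by (auto simp: sentences_def)
  show "finite {B. set B \<subseteq> ?W \<and> length B \<le> n}"
    by (intro finite_lists_length_le assms)
qed

end

theory Submission
  imports Defs
begin

text \<open>A tableau \<open>T\<close> is determined by its increasing list \<open>js\<close> of entries together with its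
  standardization \<open>T\<^sub>0\<close>, which replaces the \<open>i\<close>-th smallest entry of \<open>T\<close> by \<open>i\<close>.  The
  type of \<open>T\<^sub>0\<close> is the type \<open>B\<close> of \<open>T\<close> with the empty words removed, and as empty words
  contribute the factor \<open>1\<close>, the monomial of \<open>T\<close> is the term of \<open>M\<^sub>B\<close> at \<open>js\<close>.  Comparing
  coefficients, the theorem says that \<open>T \<mapsto> (T\<^sub>0, js)\<close> is a bijection.\<close>

section \<open>Coefficients of formal sums and products with trivial factors\<close>

text \<open>Each member of the family contributes 1 or 0 at \<open>m\<close>, so identities between
  coefficients become counting statements. If infinitely many members hit \<open>m\<close>, both
  sides are 0 by convention.\<close>

lemma formal_sum_monomial_series:
  "(formal_sum (\<lambda>i. monomial_series (f i)) S m :: 'r::comm_ring_1) =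
    of_nat (card {i \<in> S. f i = m})"
proof -
  have eq: "{i \<in> S. (monomial_series (f i) m :: 'r) \<noteq> 0} = {i \<in> S. f i = m}"
    by (auto simp: monomial_series_def)
  show ?thesis
    unfolding formal_sum_def eq by (simp add: monomial_series_def)
qed

lemma word_monomial_Nil [simp]: "word_monomial [] i = 1"
  by (simp add: word_monomial_def)

lemma sentence_monomial_map:
  "sentence_monomial (map h es) es = (\<Prod>e\<leftarrow>es. word_monomial (h e) e)"
  by (simp add: sentence_monomial_def zip_map1 zip_same_conv_map o_def)

lemma prod_list_filter_neq_1:
  fixes f :: "'b \<Rightarrow> 'c::monoid_mult"
  assumes "\<And>x. x \<in> set xs \<Longrightarrow> \<not> P x \<Longrightarrow> f x = 1"
  shows "(\<Prod>x\<leftarrow>filter P xs. f x) = (\<Prod>x\<leftarrow>xs. f x)"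
  using assms by (induction xs) auto

section \<open>Words of colors read off a filling\<close>

lemma map_hd_map_map: "(\<And>t. t \<in> set T \<Longrightarrow> t \<noteq> []) \<Longrightarrow> map hd (map (map f) T) = map f (map hd T)"
  by (simp add: hd_map)

lemma row_colors_eq_Nil: "i \<notin> set t \<Longrightarrow> row_colors i w t = []"
  by (auto simp: row_colors_def filter_empty_conv dest: set_zip_rightD)

lemma length_row_colors:
  "length w = length t \<Longrightarrow> length (row_colors i w t) = count_list t i"
  unfolding row_colors_def by (induction w t rule: list_induct2) auto

text \<open>Injectivity must include \<open>e\<close> itself: in a row that does not contain
  \<open>e\<close>, another entry could otherwise be sent to \<open>f e\<close>.\<close>

lemma row_colors_map:
  assumes "inj_on f (insert e (set t))"
  shows "row_colors (f e) w (map f t) = row_colors e w t"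
proof -
  have "filter (\<lambda>(c, x). f x = f e) (zip w t) = filter (\<lambda>(c, x). x = e) (zip w t)"
    using assms by (intro filter_cong) (auto simp: inj_on_def dest: set_zip_rightD)
  then show ?thesis
    by (simp add: row_colors_def zip_map2 filter_map o_def case_prod_unfold)
qed

lemma entry_word_eq_Nil:
  assumes "e \<notin> set (concat T)"
  shows "entry_word J T e = []"
  using assms by (auto simp: entry_word_def row_colors_eq_Nil dest: set_zip_rightD)

lemma set_entry_word: "set (entry_word J T e) \<subseteq> set (concat J)"
  by (force simp: entry_word_def row_colors_def dest: set_zip_leftD)

lemma entry_word_map:
  assumes "inj_on f (insert e (set (concat T)))"
  shows "entry_word J (map (map f) T) (f e) = entry_word J T e"
proof -
  have "row_colors (f e) w (map f t) = row_colors e w t" if "(w, t) \<in> set (zip J T)" for w t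
    using set_zip_rightD[OF that] by (intro row_colors_map inj_on_subset[OF assms]) auto
  then show ?thesis
    by (auto simp: entry_word_def zip_map2 case_prod_unfold intro!: arg_cong[where f = concat])
qed

lemma length_entry_word:
  assumes "map length T = map length J"
  shows "length (entry_word J T e) = (\<Sum>t\<leftarrow>T. count_list t e)"
proof -
  have "length T = length J"
    using assms by (rule map_eq_imp_length_eq)
  then show ?thesis
    using assms
    by (induction T J rule: list_induct2) (auto simp: entry_word_def length_row_colors)
qed

section \<open>Entries, size of the type, and order-preserving changes of entries\<close>

lemma is_CIT_entry_ge_1: "is_CIT J T \<Longrightarrow> e \<in> set (concat T) \<Longrightarrow> 1 \<le> e"
  by (auto simp: is_CIT_def)

lemma entries_subset: "is_CIT J T \<Longrightarrow> set (concat T) \<subseteq> {1..max_entry T}"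
  using is_CIT_entry_ge_1 entry_le_max_entry by (metis atLeastAtMost_iff subsetI)

lemma length_CIT_type [simp]: "length (CIT_type J T) = max_entry T"
  by (simp add: CIT_type_def)

lemma is_CIT_rows_nonempty:
  assumes "is_CIT J T" "J \<in> sentences A" "t \<in> set T"
  shows "t \<noteq> []"
proof -
  have "length t \<in> set (map length T)"
    using assms(3) by simp
  also have "map length T = map length J"
    using assms(1) by (simp add: is_CIT_def)
  finally obtain w where "w \<in> set J" "length t = length w"
    by auto
  moreover from this(1) have "w \<noteq> []"
    using assms(2) by (simp add: sentences_def)
  ultimately show ?thesis
    by (metis length_0_conv)
qed

text \<open>Double counting of boxes, by entry and by row. This is what confines the expansion to
  sentences \<open>B\<close> of the size of \<open>J\<close>.\<close>

lemma sentence_size_CIT_type: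
  assumes "is_CIT J T"
  shows "sentence_size (CIT_type J T) = sentence_size J"
proof -
  have shape: "map length T = map length J"
    using assms by (simp add: is_CIT_def)
  have swap: "(\<Sum>e\<in>E. \<Sum>t\<leftarrow>T. count_list t e) = (\<Sum>t\<leftarrow>T. \<Sum>e\<in>E. count_list t e)"
    for E and T :: "nat list list"
    by (induction T) (simp_all add: sum.distrib)
  have "sentence_size (CIT_type J T) = (\<Sum>e\<leftarrow>[1..<Suc (max_entry T)]. length (entry_word J T e))"
    by (simp add: sentence_size_def CIT_type_def o_def)
  also have "\<dots> = (\<Sum>e\<in>{1..max_entry T}. \<Sum>t\<leftarrow>T. count_list t e)"
    by (simp add: length_entry_word[OF shape] sum_list_distinct_conv_sum_set
        atLeastLessThanSuc_atLeastAtMost del: upt_Suc)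
  also have "\<dots> = (\<Sum>t\<leftarrow>T. \<Sum>e\<in>{1..max_entry T}. count_list t e)"
    by (rule swap)
  also have "\<dots> = (\<Sum>t\<leftarrow>T. length t)"
    using entries_subset[OF assms]
    by (intro arg_cong[where f = sum_list] map_cong refl sum_count_set) auto
  finally show ?thesis
    by (simp add: shape sentence_size_def)
qed

text \<open>A strictly increasing change of entries keeps both the weak order in the rows and the
  strict order in the first column. Words of \<open>J\<close> are nonempty, so every row has a head
  and \<open>hd\<close> commutes with the map.\<close>

lemma is_CIT_map:
  assumes T: "is_CIT J T" and J: "J \<in> sentences A"
    and mono: "strict_mono_on (set (concat T)) f"
    and pos: "\<And>e. e \<in> set (concat T) \<Longrightarrow> 1 \<le> f e"
  shows "is_CIT J (map (map f) T)"
proof -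
  have ne: "t \<noteq> []" if "t \<in> set T" for t
    using is_CIT_rows_nonempty[OF T J that] .
  have rows: "sorted (map f t)" if t: "t \<in> set T" for t
  proof -
    have "sorted_wrt (\<le>) t"
      using T t by (simp add: is_CIT_def)
    then have "sorted_wrt (\<lambda>x y. f x \<le> f y) t"
      by (rule sorted_wrt_mono_rel[rotated])
        (use t in \<open>auto intro!: strict_mono_on_leD[OF mono]\<close>)
    then show ?thesis
      by (simp add: sorted_wrt_map)
  qed
  have "sorted_wrt (<) (map hd (map (map f) T))"
  proof -
    have "sorted_wrt (<) (map hd T)"
      using T by (simp add: is_CIT_def)
    moreover have sub: "set (map hd T) \<subseteq> set (concat T)"
      using ne by (auto intro: hd_in_set)
    have "f x < f y" if "x \<in> set (map hd T)" "y \<in> set (map hd T)" "x < y" for x y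
      using that sub by (intro strict_mono_onD[OF mono]) (simp_all only: subsetD)
    ultimately have "sorted_wrt (\<lambda>x y. f x < f y) (map hd T)"
      by (rule sorted_wrt_mono_rel[rotated])
    then show ?thesis
      by (subst map_hd_map_map) (use ne in \<open>simp_all add: sorted_wrt_map\<close>)
  qed
  moreover have "\<forall>t\<in>set (map (map f) T). sorted t"
    using rows by auto
  moreover have "map length (map (map f) T) = map length J"
    using T by (simp add: is_CIT_def o_def)
  moreover have "\<forall>t\<in>set (map (map f) T). \<forall>e\<in>set t. 1 \<le> e"
    using pos by auto
  ultimately show ?thesis
    unfolding is_CIT_def by (intro conjI)
qed

text \<open>Indices up to the maximum that do not occur as entries carry the empty word, hence the
  factor 1, and drop out of the product.\<close>

lemma CIT_monomial_eq_entries: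
  assumes T: "is_CIT J T" and es: "sorted_wrt (<) es" "set es = set (concat T)"
  shows "CIT_monomial J T = sentence_monomial (map (entry_word J T) es) es"
proof -
  have "es = filter (\<lambda>e. e \<in> set (concat T)) [1..<Suc (max_entry T)]"
  proof (rule strict_sorted_equal)
    show "sorted_wrt (<) (filter (\<lambda>e. e \<in> set (concat T)) [1..<Suc (max_entry T)])"
      by (intro sorted_wrt_filter) (simp del: upt_Suc)
    show "set es = set (filter (\<lambda>e. e \<in> set (concat T)) [1..<Suc (max_entry T)])"
      using entries_subset[OF T] es(2) by (auto simp del: upt_Suc)
  qed (rule es)
  then show ?thesis
    by (simp add: CIT_monomial_def CIT_type_def sentence_monomial_map prod_list_filter_neq_1
        entry_word_eq_Nil del: upt_Suc set_concat)
qed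

text \<open>The letters of a type come from \<open>J\<close> and so lie in \<open>A\<close>; only an
  empty word can keep the type from being a sentence, and the word of \<open>e\<close> is empty
  exactly when \<open>e\<close> is skipped as an entry.\<close>

lemma CIT_type_in_sentences_iff:
  assumes T: "is_CIT J T" and J: "J \<in> sentences A"
  shows "CIT_type J T \<in> sentences A \<longleftrightarrow> set (concat T) = {1..max_entry T}"
proof -
  have "set (entry_word J T e) \<subseteq> A" for e
    using set_entry_word[of J T e] J by (auto simp: sentences_def)
  moreover have "entry_word J T e \<noteq> [] \<longleftrightarrow> e \<in> set (concat T)" for e
    using entry_word_nonempty[of T J e] entry_word_eq_Nil[of e T J] T
    by (auto simp: is_CIT_def)
  ultimately have "CIT_type J T \<in> sentences A \<longleftrightarrow> {1..max_entry T} \<subseteq> set (concat T)"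
    by (auto simp: sentences_def CIT_type_def Suc_le_eq less_Suc_eq_le
        simp del: upt_Suc set_concat)
  then show ?thesis
    using entries_subset[OF T] by blast
qed

section \<open>Standardization of tableaux as a bijection\<close>

text \<open>The tableaux counted by \<open>CIT_count J B\<close> for some sentence \<open>B\<close>
  over \<open>A\<close>. Entries may repeat; only gaps among the values are excluded.\<close>

definition standard_CITs :: "'a set \<Rightarrow> 'a sentence \<Rightarrow> nat list list set" where
  "standard_CITs A J = {T. is_CIT J T \<and> CIT_type J T \<in> sentences A}"

text \<open>Inverse of standardization. The shift in \<open>e - 1\<close> arises because entries
  start at 1 and list positions at 0.\<close>

definition relabel :: "nat list list \<times> nat list \<Rightarrow> nat list list" where
  "relabel = (\<lambda>(T, js). map (map (\<lambda>e. js ! (e - 1))) T)"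

lemma relabel_strict_mono:
  assumes "js \<in> increasing_indices n"
  shows "strict_mono_on {1..n} (\<lambda>e. js ! (e - 1))"
proof (rule strict_mono_onI)
  fix d e assume "d \<in> {1..n}" "e \<in> {1..n}" "d < e"
  then show "js ! (d - 1) < js ! (e - 1)"
    using assms by (intro sorted_wrt_nth_less[of "(<)" js]) (auto simp: increasing_indices_def)
qed

lemma relabel_image:
  assumes "length js = n"
  shows "(\<lambda>e. js ! (e - 1)) ` {1..n} = set js"
proof -
  have "(\<lambda>e. js ! (e - 1)) ` {1..n} = (\<lambda>i. js ! i) ` {0..<n}"
    unfolding image_Suc_lessThan[symmetric] by (auto simp: image_image atLeast0LessThan)
  with assms show ?thesis
    by (auto simp: set_conv_nth)
qed

context
  fixes A :: "'a set" and J :: "'a sentence"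
  assumes J: "J \<in> sentences A"
begin

lemma standard_entries: "T \<in> standard_CITs A J \<Longrightarrow> set (concat T) = {1..max_entry T}"
  using CIT_type_in_sentences_iff[OF _ J] unfolding standard_CITs_def by blast

lemma relabel_entries:
  assumes "T \<in> standard_CITs A J" "js \<in> increasing_indices (max_entry T)"
  shows "set (concat (relabel (T, js))) = set js"
proof -
  have "set (concat (relabel (T, js))) = (\<lambda>e. js ! (e - 1)) ` set (concat T)"
    by (auto simp: relabel_def)
  also have "\<dots> = set js"
    unfolding standard_entries[OF assms(1)]
    using assms(2) by (intro relabel_image) (simp add: increasing_indices_def)
  finally show ?thesis .
qed

lemma is_CIT_relabel:
  assumes T: "T \<in> standard_CITs A J" and js: "js \<in> increasing_indices (max_entry T)"
  shows "is_CIT J (relabel (T, js))"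
  unfolding relabel_def prod.case
proof (rule is_CIT_map[OF _ J])
  show "is_CIT J T"
    using T by (simp add: standard_CITs_def)
  show "strict_mono_on (set (concat T)) (\<lambda>e. js ! (e - 1))"
    unfolding standard_entries[OF T] by (rule relabel_strict_mono[OF js])
  fix e assume "e \<in> set (concat T)"
  then have "js ! (e - 1) \<in> set js"
    unfolding standard_entries[OF T] using js by (auto simp: increasing_indices_def)
  then show "1 \<le> js ! (e - 1)"
    using js by (simp add: increasing_indices_def)
qed

text \<open>Relabeling moves no box, so the word of \<open>js ! i\<close> after relabeling is the
  word of \<open>Suc i\<close> before it; read along \<open>js\<close>, these words form the type of
  \<open>T\<close>.\<close>

lemma CIT_monomial_relabel:
  assumes T: "T \<in> standard_CITs A J" and js: "js \<in> increasing_indices (max_entry T)"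
  shows "CIT_monomial J (relabel (T, js)) = sentence_monomial (CIT_type J T) js"
proof -
  let ?f = "\<lambda>e. js ! (e - 1)" and ?n = "max_entry T"
  have "inj_on ?f {1..?n}"
    using relabel_strict_mono[OF js] by (rule strict_mono_on_imp_inj_on)
  then have "entry_word J (relabel (T, js)) (js ! i) = entry_word J T (Suc i)" if "i < ?n" for i
    using that entry_word_map[of ?f "Suc i" T J] unfolding standard_entries[OF T]
    by (simp add: relabel_def insert_absorb)
  moreover have "length js = ?n"
    using js by (simp add: increasing_indices_def)
  ultimately have "map (entry_word J (relabel (T, js))) js = CIT_type J T"
    by (intro nth_equalityI) (simp_all add: CIT_type_def del: upt_Suc)
  then show ?thesis
    using CIT_monomial_eq_entries[OF is_CIT_relabel[OF T js] _ relabel_entries[OF T js, symmetric]] js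
    by (simp add: increasing_indices_def)
qed

text \<open>The image determines \<open>js\<close> as its increasing list of entries. For fixed
  \<open>js\<close> the map on \<open>{1..n}\<close> is injective, and this passes to rows and then
  to lists of rows.\<close>

lemma inj_on_relabel:
  "inj_on relabel (SIGMA T:standard_CITs A J. increasing_indices (max_entry T))"
proof (rule inj_onI, clarify, rule conjI)
  fix T js T' js'
  assume T: "T \<in> standard_CITs A J" and js: "js \<in> increasing_indices (max_entry T)"
    and T': "T' \<in> standard_CITs A J" and js': "js' \<in> increasing_indices (max_entry T')"
    and eq: "relabel (T, js) = relabel (T', js')"
  have "set js = set js'"
    using relabel_entries[OF T js] relabel_entries[OF T' js'] eq by simp
  then show js_eq: "js = js'"
    using js js' by (intro strict_sorted_equal) (simp_all add: increasing_indices_def)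
  let ?n = "length js" and ?f = "\<lambda>e. js ! (e - 1)"
  have len: "max_entry T = ?n" "max_entry T' = ?n"
    using js js' js_eq by (simp_all add: increasing_indices_def)
  have "inj_on ?f {1..?n}"
    using relabel_strict_mono js len(1) by (metis strict_mono_on_imp_inj_on)
  then have "inj_on (map ?f) (lists {1..?n})"
    by (rule inj_on_map_lists)
  then have "inj_on (map (map ?f)) (lists (lists {1..?n}))"
    by (rule inj_on_map_lists)
  moreover have "T \<in> lists (lists {1..?n})" "T' \<in> lists (lists {1..?n})"
    using standard_entries[OF T] standard_entries[OF T'] len by auto
  ultimately show "T = T'"
    using eq js_eq by (auto simp: relabel_def dest: inj_onD)
qed

text \<open>The preimage is the standardization of \<open>T\<close>: each entry is replaced by its
  rank among the distinct entries.\<close>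

lemma ex_relabel:
  assumes T: "is_CIT J T"
  shows "\<exists>T0 js. T0 \<in> standard_CITs A J \<and> js \<in> increasing_indices (max_entry T0) \<and>
    relabel (T0, js) = T"
proof -
  define js where "js = sorted_list_of_set (set (concat T))"
  define n where "n = length js"
  let ?f = "\<lambda>e. js ! (e - 1)"
  have set_js: "set js = set (concat T)" and sorted_js: "sorted_wrt (<) js"
    by (simp_all add: js_def del: set_concat)
  have js: "js \<in> increasing_indices n"
    using is_CIT_entry_ge_1[OF T] set_js sorted_js by (simp add: increasing_indices_def n_def)
  have img: "?f ` {1..n} = set (concat T)"
    using relabel_image[of js n] set_js n_def by simp
  \<comment> \<open>\<open>g\<close> is the rank function, inverse to reading off the entry of a
    given rank.\<close>
  define g where "g = the_inv_into {1..n} ?f"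
  have inj: "inj_on ?f {1..n}"
    using relabel_strict_mono[OF js] by (rule strict_mono_on_imp_inj_on)
  have g_img: "g ` set (concat T) = {1..n}"
    unfolding g_def img[symmetric] using inj by (rule the_inv_into_onto)
  have fg: "?f (g e) = e" if "t \<in> set T" "e \<in> set t" for t e
    using that f_the_inv_into_f[OF inj] unfolding g_def img by auto
  have mono: "strict_mono_on (set (concat T)) g"
  proof (rule strict_mono_onI)
    fix x y assume xy: "x \<in> set (concat T)" "y \<in> set (concat T)" "x < y"
    then have "g x \<in> {1..n}" "g y \<in> {1..n}" "?f (g x) < ?f (g y)"
      using g_img fg by (blast, blast, auto)
    then show "g x < g y"
      using strict_mono_on_less[OF relabel_strict_mono[OF js]] by blast
  qed
  define T0 where "T0 = map (map g) T"
  have CIT0: "is_CIT J T0"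
    unfolding T0_def using g_img by (intro is_CIT_map[OF T J mono]) (metis atLeastAtMost_iff imageI)
  have "set (concat T0) = g ` set (concat T)"
    by (auto simp: T0_def)
  then have entries0: "set (concat T0) = {1..n}"
    by (simp only: g_img)
  \<comment> \<open>The 0 inserted in \<open>max_entry\<close> covers the case \<open>n = 0\<close>
    of an empty filling.\<close>
  have max0: "max_entry T0 = n"
    unfolding max_entry_def entries0 by (rule Max_eqI) auto
  have "T0 \<in> standard_CITs A J"
    using CIT0 CIT_type_in_sentences_iff[OF CIT0 J] entries0 max0
    by (simp add: standard_CITs_def del: set_concat)
  moreover have "relabel (T0, js) = T"
    unfolding relabel_def T0_def prod.case map_map
    by (intro map_idI) (auto simp: fg[simplified] intro!: map_idI)
  ultimately show ?thesis
    using js max0 by blast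
qed

text \<open>Restriction of the bijection \<open>relabel\<close> to the pairs whose monomial is
  \<open>m\<close>.\<close>

lemma card_CIT_monomial:
  "card {T. is_CIT J T \<and> CIT_monomial J T = m} =
    card (SIGMA T:standard_CITs A J.
      {js \<in> increasing_indices (length (CIT_type J T)). sentence_monomial (CIT_type J T) js = m})"
  (is "card ?L = card ?R")
proof -
  have "inj_on relabel ?R"
    by (rule inj_on_subset[OF inj_on_relabel]) auto
  then have "card (relabel ` ?R) = card ?R"
    by (rule card_image)
  moreover have "relabel ` ?R = ?L"
  proof (intro equalityI subsetI)
    fix T assume "T \<in> relabel ` ?R"
    then obtain T0 js where T0: "T0 \<in> standard_CITs A J" "js \<in> increasing_indices (max_entry T0)"
      and m: "sentence_monomial (CIT_type J T0) js = m" and T: "T = relabel (T0, js)"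
      by auto
    show "T \<in> ?L"
      using is_CIT_relabel[OF T0] CIT_monomial_relabel[OF T0] m unfolding T by blast
  next
    fix T assume "T \<in> ?L"
    then have T: "is_CIT J T" "CIT_monomial J T = m"
      by auto
    obtain T0 js where T0: "T0 \<in> standard_CITs A J" "js \<in> increasing_indices (max_entry T0)"
      and T_eq: "T = relabel (T0, js)"
      using ex_relabel[OF T(1)] by blast
    have "sentence_monomial (CIT_type J T0) js = m"
      using CIT_monomial_relabel[OF T0] T(2) unfolding T_eq by simp
    then show "T \<in> relabel ` ?R"
      unfolding T_eq using T0 by (intro imageI) simp
  qed
  ultimately show ?thesis
    by (simp only:)
qed

end

section \<open>Comparison of coefficients\<close>

theorem theorem4p20:
  fixes A :: "'a set" and J :: "'a sentence"
  assumes "finite A" and "J \<in> sentences A"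
  shows "(dual_immaculate J :: ('a, 'r::comm_ring_1) series) =
    (\<lambda>m. \<Sum>B\<in>{B \<in> sentences A. sentence_size B = sentence_size J}.
           of_nat (CIT_count J B) * colored_M B m)"
proof
  fix m :: "'a monomial"
  let ?S = "{B \<in> sentences A. sentence_size B = sentence_size J}"
  let ?X = "standard_CITs A J"
  let ?D = "\<lambda>B. {js \<in> increasing_indices (length B). sentence_monomial B js = m}"
  have finS: "finite ?S"
    using assms(1) by (rule finite_sentences_of_size)
  have type_in: "CIT_type J ` ?X \<subseteq> ?S"
    using sentence_size_CIT_type by (auto simp: standard_CITs_def)
  \<comment> \<open>A tableau whose type is the sentence \<open>B\<close> is automatically in
    \<open>?X\<close>, so the fiber is the set behind \<open>CIT_count J B\<close>.\<close>
  have fiber: "{T \<in> ?X. CIT_type J T = B} = {T. is_CIT J T \<and> CIT_type J T = B}"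
    if "B \<in> ?S" for B
    using that by (auto simp: standard_CITs_def)
  have "?X \<subseteq> (\<Union>B\<in>?S. {T. is_CIT J T \<and> CIT_type J T = B})"
    using type_in by (auto simp: standard_CITs_def)
  then have finX: "finite ?X"
    by (rule finite_subset) (use finS finite_CIT_of_type in blast)
  have "card {T. is_CIT J T \<and> CIT_monomial J T = m} = (\<Sum>T\<in>?X. card (?D (CIT_type J T)))"
    unfolding card_CIT_monomial[OF assms(2)]
    using finX finite_colored_M_family
    by (intro card_SigmaI) (auto simp: standard_CITs_def simp del: length_CIT_type)
  \<comment> \<open>The number of index lists depends on \<open>T\<close> only through its type, so
    grouping by type makes the inner summand constant.\<close>
  also have "\<dots> = (\<Sum>B\<in>?S. \<Sum>T\<in>{T \<in> ?X. CIT_type J T = B}. card (?D (CIT_type J T)))"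
    using finX finS type_in by (rule sum.group[symmetric])
  also have "\<dots> = (\<Sum>B\<in>?S. CIT_count J B * card (?D B))"
  proof (intro sum.cong refl)
    fix B assume B: "B \<in> ?S"
    have "(\<Sum>T\<in>{T \<in> ?X. CIT_type J T = B}. card (?D (CIT_type J T))) =
        card {T \<in> ?X. CIT_type J T = B} * card (?D B)"
      by simp
    then show "(\<Sum>T\<in>{T \<in> ?X. CIT_type J T = B}. card (?D (CIT_type J T))) =
        CIT_count J B * card (?D B)"
      unfolding CIT_count_def fiber[OF B] .
  qed
  finally have count: "card {T. is_CIT J T \<and> CIT_monomial J T = m} =
      (\<Sum>B\<in>?S. CIT_count J B * card (?D B))" .
  have "dual_immaculate J m = (of_nat (card {T. is_CIT J T \<and> CIT_monomial J T = m}) :: 'r)"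
    by (simp add: dual_immaculate_def formal_sum_monomial_series)
  then show "(dual_immaculate J m :: 'r) = (\<Sum>B\<in>?S. of_nat (CIT_count J B) * colored_M B m)"
    unfolding count by (simp add: colored_M_def formal_sum_monomial_series)
qed

end
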